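(* Let $D:\Gamma(E)\to\Gamma(F)$ be a conformal, injectively elliptic, first order linear differential operator between Riemannian vector bundles $E,F\to M$, with ellipticity constant $\epsilon$ and conformity factor $\rho$, written $D=P\circ\nabla$ with $\nabla$ a metric connection on $E$ and $P$ the principal symbol of $D$. Fix a constant $c\ge 0$. Let $\phi$ be a section of $E$ and let $x$ be a point in $M$ such that $\phi(x)\neq 0$. Then at $x$ the following pointwise inequality holds: $$|\nabla\phi|^{2}+c\,|D\phi|^{2}\ \geq\ (1+\tilde c)\,\bigl|d|\phi|\bigr|^{2},$$ where $$\tilde c=\begin{cases}\dfrac{\epsilon}{\rho^{2}-\epsilon} & \text{if } (D\phi)_x=0,\\[2mm] \dfrac{\epsilon c}{1+(\rho^{2}-\epsilon)c} & \text{if } (D\phi)_x\neq 0.\end{cases}$$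
   Context: $M$ is a Riemannian manifold and $\Gamma(E)$ denotes the space of sections of $E$. A first order linear differential operator $D:\Gamma(E)\to\Gamma(F)$ between Riemannian vector bundles over $M$ is, here, a composition $D=P\circ\nabla$, where $\nabla:\Gamma(E)\to\Gamma(T^*M\otimes E)$ is a metric connection on $E$ and $P=\sigma(D):T^*M\otimes E\to F$ is a bundle morphism, called the principal symbol. For $\xi\in T^*_xM$ put $P_\xi:E_x\to F_x$, $P_\xi(v)=P(\xi\otimes v)$. A surjective linear operator $P:V\to W$ between inner product spaces is a conformal projection if $PP^*=\rho^2\,\mathrm{id}_W$ for some constant $\rho>0$, called its conformity factor. The operator $D$ is conformal if $P_x:T^*_xM\otimes E_x\to F_x$ is a conformal projection for every $x\in M$; the conformity factor $\rho$ of $D$ at $x$ is the conformity factor of $P_x$. The operator $D$ is injectively elliptic at $x$ if $P_\xi^*P_\xi:E_x\to E_x$ is bijective for every unit vector $\xi\in T^*_xM$; the ellipticity constant of $D$ at $x$ is $\epsilon=\inf_{|\xi|=1}\inf_{|v|=1}|P_\xi(v)|^2$. In the inequality at $x$, $\rho$ and $\epsilon$ denote the values at $x$. *)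

theory Defs
  imports "HOL-Analysis.Analysis" "HOL-Library.Function_Algebras"
begin

text \<open>
  Manifolds, vector bundles and connections. The underlying space of a manifold is a Hausdorff,
  second countable type \<open>'p\<close>, modelled on a Euclidean space \<open>'m\<close>. The fibres of a vector bundle
  are linear subspaces of one ambient real vector space \<open>'v\<close>; this ambient space is only a
  container for the fibres (for an arbitrary bundle one may take the direct sum of all its fibres)
  and carries no norm, inner product or topology.
\<close>

subsection \<open>Function spaces as vector spaces\<close>

instantiation "fun" :: (type, real_vector) real_vector
begin

definition scaleR_fun :: "real \<Rightarrow> ('a \<Rightarrow> 'b) \<Rightarrow> 'a \<Rightarrow> 'b"
  where "scaleR_fun r f = (\<lambda>x. r *\<^sub>R f x)"

instance
  by standard (auto simp: scaleR_fun_def fun_eq_iff plus_fun_def algebra_simps)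

end

subsection \<open>Linear algebra on subspaces\<close>

definition linear_map_on :: "'v::real_vector set \<Rightarrow> 'w::real_vector set \<Rightarrow> ('v \<Rightarrow> 'w) \<Rightarrow> bool" where
  "linear_map_on V W L \<longleftrightarrow>
     (\<forall>v\<in>V. L v \<in> W) \<and>
     (\<forall>u\<in>V. \<forall>v\<in>V. L (u + v) = L u + L v) \<and>
     (\<forall>r. \<forall>v\<in>V. L (r *\<^sub>R v) = r *\<^sub>R L v)"

definition inner_product_on :: "'v::real_vector set \<Rightarrow> ('v \<Rightarrow> 'v \<Rightarrow> real) \<Rightarrow> bool" where
  "inner_product_on V g \<longleftrightarrow>
     (\<forall>u\<in>V. \<forall>v\<in>V. g u v = g v u) \<and>
     (\<forall>u\<in>V. linear_map_on V UNIV (g u)) \<and>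
     (\<forall>v\<in>V. v \<noteq> 0 \<longrightarrow> g v v > 0)"

definition norm_of :: "('v \<Rightarrow> 'v \<Rightarrow> real) \<Rightarrow> 'v \<Rightarrow> real" where
  "norm_of g v = sqrt (g v v)"

definition orthonormal_basis_on ::
    "'v::real_vector set \<Rightarrow> ('v \<Rightarrow> 'v \<Rightarrow> real) \<Rightarrow> 'v set \<Rightarrow> bool" where
  "orthonormal_basis_on V g B \<longleftrightarrow>
     finite B \<and> B \<subseteq> V \<and> span B = V \<and> (\<forall>a\<in>B. \<forall>b\<in>B. g a b = (if a = b then 1 else 0))"

definition adjoint_on ::
    "'v::real_vector set \<Rightarrow> ('v \<Rightarrow> 'v \<Rightarrow> real) \<Rightarrow> ('w \<Rightarrow> 'w \<Rightarrow> real) \<Rightarrow> ('v \<Rightarrow> 'w) \<Rightarrow> 'w \<Rightarrow> 'v" where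
  "adjoint_on V gV gW L w = (THE u. u \<in> V \<and> (\<forall>v\<in>V. gV v u = gW (L v) w))"

text \<open>
  \<open>Hom(V, W)\<close>, identified with \<open>V\<^sup>* \<otimes> W\<close>. Its elements vanish off \<open>V\<close>, so that each linear map is
  represented by exactly one function.
\<close>

definition hom_space :: "'v::real_vector set \<Rightarrow> 'w::real_vector set \<Rightarrow> ('v \<Rightarrow> 'w) set" where
  "hom_space V W = {T. linear_map_on V W T \<and> (\<forall>v. v \<notin> V \<longrightarrow> T v = 0)}"

text \<open>
  The tensor product inner product on \<open>V\<^sup>* \<otimes> W = Hom(V, W)\<close>, which does not depend on the chosen
  orthonormal basis of \<open>V\<close>. For \<open>W = \<real>\<close> it is the dual inner product on \<open>V\<^sup>*\<close>.
\<close>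

definition hom_inner ::
    "'v::real_vector set \<Rightarrow> ('v \<Rightarrow> 'v \<Rightarrow> real) \<Rightarrow> ('w \<Rightarrow> 'w \<Rightarrow> real) \<Rightarrow> ('v \<Rightarrow> 'w) \<Rightarrow> ('v \<Rightarrow> 'w) \<Rightarrow> real" where
  "hom_inner V gV gW S T = (\<Sum>e\<in>(SOME B. orthonormal_basis_on V gV B). gW (S e) (T e))"

definition tensor :: "('v \<Rightarrow> real) \<Rightarrow> 'w::real_vector \<Rightarrow> 'v \<Rightarrow> 'w" where
  "tensor \<xi> w = (\<lambda>v. \<xi> v *\<^sub>R w)"

definition conformal_projection ::
    "'v::real_vector set \<Rightarrow> ('v \<Rightarrow> 'v \<Rightarrow> real) \<Rightarrow> 'w::real_vector set \<Rightarrow> ('w \<Rightarrow> 'w \<Rightarrow> real) \<Rightarrow>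
     ('v \<Rightarrow> 'w) \<Rightarrow> real \<Rightarrow> bool" where
  "conformal_projection V gV W gW L \<rho> \<longleftrightarrow>
     linear_map_on V W L \<and> L ` V = W \<and> \<rho> > 0 \<and>
     (\<forall>w\<in>W. L (adjoint_on V gV gW L w) = \<rho>\<^sup>2 *\<^sub>R w)"

subsection \<open>Smooth manifolds\<close>

primrec Ck_on ::
    "nat \<Rightarrow> ('a::euclidean_space \<Rightarrow> 'b::real_normed_vector) \<Rightarrow> 'a set \<Rightarrow> bool" where
  "Ck_on 0 f S = continuous_on S f"
| "Ck_on (Suc k) f S =
     ((\<forall>x\<in>S. f differentiable (at x)) \<and> (\<forall>v. Ck_on k (\<lambda>x. frechet_derivative f (at x) v) S))"

text \<open>Smoothness on an open set \<open>S\<close>.\<close>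

definition smooth_on :: "('a::euclidean_space \<Rightarrow> 'b::real_normed_vector) \<Rightarrow> 'a set \<Rightarrow> bool" where
  "smooth_on f S \<longleftrightarrow> (\<forall>k. Ck_on k f S)"

text \<open>A chart is a pair of a domain and a coordinate map; only values on the domain matter.\<close>

type_synonym ('p, 'm) chart = "'p set \<times> ('p \<Rightarrow> 'm)"

definition chart_inv :: "('p, 'm) chart \<Rightarrow> 'm \<Rightarrow> 'p" where
  "chart_inv c = inv_into (fst c) (snd c)"

definition smooth_atlas ::
    "('p::{t2_space, second_countable_topology}, 'm::euclidean_space) chart set \<Rightarrow> bool" where
  "smooth_atlas A \<longleftrightarrow>
     (\<Union>c\<in>A. fst c) = UNIV \<and>
     (\<forall>c\<in>A. open (fst c) \<and> open (snd c ` fst c) \<and>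
        homeomorphism (fst c) (snd c ` fst c) (snd c) (chart_inv c)) \<and>
     (\<forall>c\<in>A. \<forall>c'\<in>A. smooth_on (snd c' \<circ> chart_inv c) (snd c ` (fst c \<inter> fst c')))"

definition manifold_smooth_on ::
    "('p, 'm::euclidean_space) chart set \<Rightarrow> ('p \<Rightarrow> 'b::real_normed_vector) \<Rightarrow> 'p set \<Rightarrow> bool" where
  "manifold_smooth_on A f U \<longleftrightarrow> (\<forall>c\<in>A. smooth_on (f \<circ> chart_inv c) (snd c ` (fst c \<inter> U)))"

definition charts_at :: "('p, 'm) chart set \<Rightarrow> 'p \<Rightarrow> ('p, 'm) chart set" where
  "charts_at A x = {c \<in> A. x \<in> fst c}"

text \<open>
  A tangent vector at \<open>x\<close> is the family of its coordinate vectors in the charts around \<open>x\<close>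
  (and \<open>0\<close> at the other indices), related by the differentials of the chart transitions.
\<close>

definition tangent_space ::
    "('p, 'm::euclidean_space) chart set \<Rightarrow> 'p \<Rightarrow> (('p, 'm) chart \<Rightarrow> 'm) set" where
  "tangent_space A x =
     {v. (\<forall>c. c \<notin> charts_at A x \<longrightarrow> v c = 0) \<and>
         (\<forall>c\<in>charts_at A x. \<forall>c'\<in>charts_at A x.
            v c' = frechet_derivative (snd c' \<circ> chart_inv c) (at (snd c x)) (v c))}"

text \<open>The differential \<open>df\<close> at \<open>x\<close> as an element of \<open>T\<^sup>*\<^sub>x M\<close>; it does not depend on the chart.\<close>

definition differential ::
    "('p, 'm::euclidean_space) chart set \<Rightarrow> ('p \<Rightarrow> real) \<Rightarrow> 'p \<Rightarrow> (('p, 'm) chart \<Rightarrow> 'm) \<Rightarrow> real" where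
  "differential A f x v =
     (if v \<in> tangent_space A x
      then let c = (SOME c. c \<in> charts_at A x)
           in frechet_derivative (f \<circ> chart_inv c) (at (snd c x)) (v c)
      else 0)"

subsection \<open>Vector bundles\<close>

text \<open>
  A local trivialization is a pair \<open>(U, \<Phi>)\<close> where \<open>\<Phi> x\<close>, for \<open>x \<in> U\<close>, is an isomorphism from the fibre
  at \<open>x\<close> to the model fibre \<open>'k\<close>.
\<close>

record ('p, 'v, 'k) vbundle =
  fibre :: "'p \<Rightarrow> 'v set"
  trivs :: "('p set \<times> ('p \<Rightarrow> 'v \<Rightarrow> 'k)) set"

definition triv_inv ::
    "('p, 'v, 'k) vbundle \<Rightarrow> ('p set \<times> ('p \<Rightarrow> 'v \<Rightarrow> 'k)) \<Rightarrow> 'p \<Rightarrow> 'k \<Rightarrow> 'v" where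
  "triv_inv E t x = inv_into (fibre E x) (snd t x)"

text \<open>
  The model fibre is finite-dimensional in all uses, so smoothness of a transition
  \<open>U \<inter> U' \<rightarrow> GL('k)\<close> amounts to smoothness of its value at each vector of \<open>'k\<close>.
\<close>

definition vector_bundle ::
    "('p::{t2_space, second_countable_topology}, 'm::euclidean_space) chart set \<Rightarrow>
     ('p, 'v::real_vector, 'k::real_normed_vector) vbundle \<Rightarrow> bool" where
  "vector_bundle A E \<longleftrightarrow>
     (\<forall>x. subspace (fibre E x)) \<and>
     (\<Union>t\<in>trivs E. fst t) = UNIV \<and>
     (\<forall>t\<in>trivs E. open (fst t) \<and>
        (\<forall>x\<in>fst t. linear_map_on (fibre E x) UNIV (snd t x) \<and>
                   bij_betw (snd t x) (fibre E x) UNIV)) \<and>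
     (\<forall>t\<in>trivs E. \<forall>t'\<in>trivs E. \<forall>k.
        manifold_smooth_on A (\<lambda>x. snd t' x (triv_inv E t x k)) (fst t \<inter> fst t'))"

definition sections ::
    "('p, 'm::euclidean_space) chart set \<Rightarrow> ('p, 'v, 'k::real_normed_vector) vbundle \<Rightarrow> ('p \<Rightarrow> 'v) set" where
  "sections A E =
     {s. (\<forall>x. s x \<in> fibre E x) \<and> (\<forall>t\<in>trivs E. manifold_smooth_on A (\<lambda>x. snd t x (s x)) (fst t))}"

definition bundle_metric ::
    "('p, 'm::euclidean_space) chart set \<Rightarrow> ('p, 'v::real_vector, 'k) vbundle \<Rightarrow>
     ('p \<Rightarrow> 'v \<Rightarrow> 'v \<Rightarrow> real) \<Rightarrow> bool" where
  "bundle_metric A E g \<longleftrightarrow>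
     (\<forall>x. inner_product_on (fibre E x) (g x)) \<and>
     (\<forall>t\<in>trivs E. \<forall>k l.
        manifold_smooth_on A (\<lambda>x. g x (triv_inv E t x k) (triv_inv E t x l)) (fst t))"

definition tangent_bundle ::
    "('p, 'm::euclidean_space) chart set \<Rightarrow> ('p, ('p, 'm) chart \<Rightarrow> 'm, 'm) vbundle" where
  "tangent_bundle A =
     \<lparr>fibre = tangent_space A, trivs = (\<lambda>c. (fst c, \<lambda>x v. v c)) ` A\<rparr>"

definition line_bundle :: "('p, real, real) vbundle" where
  "line_bundle = \<lparr>fibre = (\<lambda>x. UNIV), trivs = {(UNIV, \<lambda>x r. r)}\<rparr>"

definition hom_bundle ::
    "('p, 'v::real_vector, 'j::real_normed_vector) vbundle \<Rightarrow>
     ('p, 'w::real_vector, 'k::real_normed_vector) vbundle \<Rightarrow> ('p, 'v \<Rightarrow> 'w, 'j \<Rightarrow>\<^sub>L 'k) vbundle" where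
  "hom_bundle E F =
     \<lparr>fibre = (\<lambda>x. hom_space (fibre E x) (fibre F x)),
      trivs = {(fst t \<inter> fst t', \<lambda>x T. Blinfun (\<lambda>j. snd t' x (T (triv_inv E t x j)))) | t t'.
                 t \<in> trivs E \<and> t' \<in> trivs F}\<rparr>"

definition hom_metric ::
    "('p, 'v::real_vector, 'j) vbundle \<Rightarrow> ('p \<Rightarrow> 'v \<Rightarrow> 'v \<Rightarrow> real) \<Rightarrow> ('p \<Rightarrow> 'w \<Rightarrow> 'w \<Rightarrow> real) \<Rightarrow>
     'p \<Rightarrow> ('v \<Rightarrow> 'w) \<Rightarrow> ('v \<Rightarrow> 'w) \<Rightarrow> real" where
  "hom_metric E gE gF x = hom_inner (fibre E x) (gE x) (gF x)"

definition cotangent_bundle ::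
    "('p, 'm::euclidean_space) chart set \<Rightarrow> ('p, (('p, 'm) chart \<Rightarrow> 'm) \<Rightarrow> real, 'm \<Rightarrow>\<^sub>L real) vbundle" where
  "cotangent_bundle A = hom_bundle (tangent_bundle A) line_bundle"

text \<open>\<open>T\<^sup>*M \<otimes> E\<close>, realised as \<open>Hom(TM, E)\<close>.\<close>

definition cotensor_bundle ::
    "('p, 'm::euclidean_space) chart set \<Rightarrow> ('p, 'v::real_vector, 'k::real_normed_vector) vbundle \<Rightarrow>
     ('p, (('p, 'm) chart \<Rightarrow> 'm) \<Rightarrow> 'v, 'm \<Rightarrow>\<^sub>L 'k) vbundle" where
  "cotensor_bundle A E = hom_bundle (tangent_bundle A) E"

definition cotangent_metric ::
    "('p, 'm::euclidean_space) chart set \<Rightarrow>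
     ('p \<Rightarrow> (('p, 'm) chart \<Rightarrow> 'm) \<Rightarrow> (('p, 'm) chart \<Rightarrow> 'm) \<Rightarrow> real) \<Rightarrow>
     'p \<Rightarrow> ((('p, 'm) chart \<Rightarrow> 'm) \<Rightarrow> real) \<Rightarrow> ((('p, 'm) chart \<Rightarrow> 'm) \<Rightarrow> real) \<Rightarrow> real" where
  "cotangent_metric A gM = hom_metric (tangent_bundle A) gM (\<lambda>x. (*))"

definition cotensor_metric ::
    "('p, 'm::euclidean_space) chart set \<Rightarrow>
     ('p \<Rightarrow> (('p, 'm) chart \<Rightarrow> 'm) \<Rightarrow> (('p, 'm) chart \<Rightarrow> 'm) \<Rightarrow> real) \<Rightarrow> ('p \<Rightarrow> 'v \<Rightarrow> 'v \<Rightarrow> real) \<Rightarrow>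
     'p \<Rightarrow> ((('p, 'm) chart \<Rightarrow> 'm) \<Rightarrow> 'v) \<Rightarrow> ((('p, 'm) chart \<Rightarrow> 'm) \<Rightarrow> 'v) \<Rightarrow> real" where
  "cotensor_metric A gM gE = hom_metric (tangent_bundle A) gM gE"

definition riemannian_manifold ::
    "('p::{t2_space, second_countable_topology}, 'm::euclidean_space) chart set \<Rightarrow>
     ('p \<Rightarrow> (('p, 'm) chart \<Rightarrow> 'm) \<Rightarrow> (('p, 'm) chart \<Rightarrow> 'm) \<Rightarrow> real) \<Rightarrow> bool" where
  "riemannian_manifold A gM \<longleftrightarrow> smooth_atlas A \<and> bundle_metric A (tangent_bundle A) gM"

definition riemannian_vector_bundle ::
    "('p::{t2_space, second_countable_topology}, 'm::euclidean_space) chart set \<Rightarrow>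
     ('p, 'v::real_vector, 'k::euclidean_space) vbundle \<Rightarrow> ('p \<Rightarrow> 'v \<Rightarrow> 'v \<Rightarrow> real) \<Rightarrow> bool" where
  "riemannian_vector_bundle A E gE \<longleftrightarrow> vector_bundle A E \<and> bundle_metric A E gE"

definition bundle_morphism ::
    "('p, 'm::euclidean_space) chart set \<Rightarrow> ('p, 'v::real_vector, 'j) vbundle \<Rightarrow>
     ('p, 'w::real_vector, 'k::real_normed_vector) vbundle \<Rightarrow> ('p \<Rightarrow> 'v \<Rightarrow> 'w) \<Rightarrow> bool" where
  "bundle_morphism A E F P \<longleftrightarrow>
     (\<forall>x. linear_map_on (fibre E x) (fibre F x) (P x)) \<and>
     (\<forall>t\<in>trivs E. \<forall>t'\<in>trivs F. \<forall>j.
        manifold_smooth_on A (\<lambda>x. snd t' x (P x (triv_inv E t x j))) (fst t \<inter> fst t'))"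

subsection \<open>Connections and first order operators\<close>

text \<open>Real-linearity follows from additivity and the Leibniz rule for constant functions.\<close>

definition connection ::
    "('p, 'm::euclidean_space) chart set \<Rightarrow> ('p, 'v::real_vector, 'k::real_normed_vector) vbundle \<Rightarrow>
     (('p \<Rightarrow> 'v) \<Rightarrow> 'p \<Rightarrow> (('p, 'm) chart \<Rightarrow> 'm) \<Rightarrow> 'v) \<Rightarrow> bool" where
  "connection A E nabla \<longleftrightarrow>
     (\<forall>s\<in>sections A E. nabla s \<in> sections A (cotensor_bundle A E)) \<and>
     (\<forall>s\<in>sections A E. \<forall>t\<in>sections A E. nabla (s + t) = nabla s + nabla t) \<and>
     (\<forall>f. \<forall>s\<in>sections A E. manifold_smooth_on A f UNIV \<longrightarrow>
        nabla (\<lambda>x. f x *\<^sub>R s x) = (\<lambda>x. tensor (differential A f x) (s x) + f x *\<^sub>R nabla s x))"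

definition metric_connection ::
    "('p, 'm::euclidean_space) chart set \<Rightarrow> ('p, 'v::real_vector, 'k::real_normed_vector) vbundle \<Rightarrow>
     ('p \<Rightarrow> 'v \<Rightarrow> 'v \<Rightarrow> real) \<Rightarrow> (('p \<Rightarrow> 'v) \<Rightarrow> 'p \<Rightarrow> (('p, 'm) chart \<Rightarrow> 'm) \<Rightarrow> 'v) \<Rightarrow> bool" where
  "metric_connection A E gE nabla \<longleftrightarrow>
     connection A E nabla \<and>
     (\<forall>s\<in>sections A E. \<forall>t\<in>sections A E. \<forall>x. \<forall>X\<in>tangent_space A x.
        differential A (\<lambda>y. gE y (s y) (t y)) x X =
          gE x (nabla s x X) (t x) + gE x (s x) (nabla t x X))"

text \<open>\<open>D = P \<circ> \<nabla>\<close> with \<open>\<nabla>\<close> a metric connection and principal symbol \<open>P\<close>.\<close>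

definition first_order_operator ::
    "('p, 'm::euclidean_space) chart set \<Rightarrow>
     ('p, 'v::real_vector, 'j::real_normed_vector) vbundle \<Rightarrow> ('p \<Rightarrow> 'v \<Rightarrow> 'v \<Rightarrow> real) \<Rightarrow>
     ('p, 'w::real_vector, 'k::real_normed_vector) vbundle \<Rightarrow>
     (('p \<Rightarrow> 'v) \<Rightarrow> 'p \<Rightarrow> (('p, 'm) chart \<Rightarrow> 'm) \<Rightarrow> 'v) \<Rightarrow>
     ('p \<Rightarrow> ((('p, 'm) chart \<Rightarrow> 'm) \<Rightarrow> 'v) \<Rightarrow> 'w) \<Rightarrow> (('p \<Rightarrow> 'v) \<Rightarrow> 'p \<Rightarrow> 'w) \<Rightarrow> bool" where
  "first_order_operator A E gE F nabla P D \<longleftrightarrow>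
     metric_connection A E gE nabla \<and>
     bundle_morphism A (cotensor_bundle A E) F P \<and>
     (\<forall>s\<in>sections A E. D s = (\<lambda>x. P x (nabla s x)))"

text \<open>\<open>\<rho>\<close> is the conformity factor at \<open>x\<close> of the operator with principal symbol \<open>P\<close>.\<close>

definition conformity_factor_at ::
    "('p, 'm::euclidean_space) chart set \<Rightarrow>
     ('p \<Rightarrow> (('p, 'm) chart \<Rightarrow> 'm) \<Rightarrow> (('p, 'm) chart \<Rightarrow> 'm) \<Rightarrow> real) \<Rightarrow>
     ('p, 'v::real_vector, 'j::real_normed_vector) vbundle \<Rightarrow> ('p \<Rightarrow> 'v \<Rightarrow> 'v \<Rightarrow> real) \<Rightarrow>
     ('p, 'w::real_vector, 'k) vbundle \<Rightarrow> ('p \<Rightarrow> 'w \<Rightarrow> 'w \<Rightarrow> real) \<Rightarrow>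
     ('p \<Rightarrow> ((('p, 'm) chart \<Rightarrow> 'm) \<Rightarrow> 'v) \<Rightarrow> 'w) \<Rightarrow> 'p \<Rightarrow> real \<Rightarrow> bool" where
  "conformity_factor_at A gM E gE F gF P x \<rho> \<longleftrightarrow>
     conformal_projection (fibre (cotensor_bundle A E) x) (cotensor_metric A gM gE x)
       (fibre F x) (gF x) (P x) \<rho>"

definition conformal ::
    "('p, 'm::euclidean_space) chart set \<Rightarrow>
     ('p \<Rightarrow> (('p, 'm) chart \<Rightarrow> 'm) \<Rightarrow> (('p, 'm) chart \<Rightarrow> 'm) \<Rightarrow> real) \<Rightarrow>
     ('p, 'v::real_vector, 'j::real_normed_vector) vbundle \<Rightarrow> ('p \<Rightarrow> 'v \<Rightarrow> 'v \<Rightarrow> real) \<Rightarrow>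
     ('p, 'w::real_vector, 'k) vbundle \<Rightarrow> ('p \<Rightarrow> 'w \<Rightarrow> 'w \<Rightarrow> real) \<Rightarrow>
     ('p \<Rightarrow> ((('p, 'm) chart \<Rightarrow> 'm) \<Rightarrow> 'v) \<Rightarrow> 'w) \<Rightarrow> bool" where
  "conformal A gM E gE F gF P \<longleftrightarrow> (\<forall>x. \<exists>\<rho>. conformity_factor_at A gM E gE F gF P x \<rho>)"

text \<open>\<open>P\<^sub>\<xi> v = P(\<xi> \<otimes> v)\<close>.\<close>

definition symbol_at ::
    "('p \<Rightarrow> ('t \<Rightarrow> 'v) \<Rightarrow> 'w) \<Rightarrow> 'p \<Rightarrow> ('t \<Rightarrow> real) \<Rightarrow> 'v::real_vector \<Rightarrow> 'w" where
  "symbol_at P x \<xi> v = P x (tensor \<xi> v)"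

definition unit_covectors ::
    "('p, 'm::euclidean_space) chart set \<Rightarrow>
     ('p \<Rightarrow> (('p, 'm) chart \<Rightarrow> 'm) \<Rightarrow> (('p, 'm) chart \<Rightarrow> 'm) \<Rightarrow> real) \<Rightarrow>
     'p \<Rightarrow> ((('p, 'm) chart \<Rightarrow> 'm) \<Rightarrow> real) set" where
  "unit_covectors A gM x =
     {\<xi> \<in> fibre (cotangent_bundle A) x. norm_of (cotangent_metric A gM x) \<xi> = 1}"

definition injectively_elliptic_at ::
    "('p, 'm::euclidean_space) chart set \<Rightarrow>
     ('p \<Rightarrow> (('p, 'm) chart \<Rightarrow> 'm) \<Rightarrow> (('p, 'm) chart \<Rightarrow> 'm) \<Rightarrow> real) \<Rightarrow>
     ('p, 'v::real_vector, 'j) vbundle \<Rightarrow> ('p \<Rightarrow> 'v \<Rightarrow> 'v \<Rightarrow> real) \<Rightarrow> ('p \<Rightarrow> 'w \<Rightarrow> 'w \<Rightarrow> real) \<Rightarrow>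
     ('p \<Rightarrow> ((('p, 'm) chart \<Rightarrow> 'm) \<Rightarrow> 'v) \<Rightarrow> 'w) \<Rightarrow> 'p \<Rightarrow> bool" where
  "injectively_elliptic_at A gM E gE gF P x \<longleftrightarrow>
     (\<forall>\<xi>\<in>unit_covectors A gM x.
        bij_betw (adjoint_on (fibre E x) (gE x) (gF x) (symbol_at P x \<xi>) \<circ> symbol_at P x \<xi>)
          (fibre E x) (fibre E x))"

definition ellipticity_constant ::
    "('p, 'm::euclidean_space) chart set \<Rightarrow>
     ('p \<Rightarrow> (('p, 'm) chart \<Rightarrow> 'm) \<Rightarrow> (('p, 'm) chart \<Rightarrow> 'm) \<Rightarrow> real) \<Rightarrow>
     ('p, 'v::real_vector, 'j) vbundle \<Rightarrow> ('p \<Rightarrow> 'v \<Rightarrow> 'v \<Rightarrow> real) \<Rightarrow> ('p \<Rightarrow> 'w \<Rightarrow> 'w \<Rightarrow> real) \<Rightarrow>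
     ('p \<Rightarrow> ((('p, 'm) chart \<Rightarrow> 'm) \<Rightarrow> 'v) \<Rightarrow> 'w) \<Rightarrow> 'p \<Rightarrow> real" where
  "ellipticity_constant A gM E gE gF P x =
     (INF \<xi>\<in>unit_covectors A gM x.
        INF v\<in>{v \<in> fibre E x. norm_of (gE x) v = 1}. (norm_of (gF x) (symbol_at P x \<xi> v))\<^sup>2)"

end

theory Submission
  imports Defs
begin

text \<open>
  Write \<open>\<xi> = d|\<phi>|\<close> and \<open>w = \<phi>/|\<phi>|\<close>. Since the connection is metric, \<open>\<xi>(X) = \<langle>\<nabla>\<^sub>X\<phi>, w\<rangle>\<close>, so that the
  tensor \<open>u = \<xi> \<otimes> w\<close> satisfies \<open>\<langle>\<nabla>\<phi>, u\<rangle> = |u|\<^sup>2 = |\<xi>|\<^sup>2\<close>, while \<open>|Pu|\<^sup>2 \<ge> \<epsilon>|\<xi>|\<^sup>2\<close> by ellipticity.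
  Conformality gives \<open>\<langle>S, u - t P\<^sup>*Pu\<rangle> + c \<langle>PS, P(u - t P\<^sup>*Pu)\<rangle> = \<langle>S, u\<rangle>\<close> for all \<open>S\<close> when
  \<open>t = c/(1 + c\<rho>\<^sup>2)\<close>, and the Cauchy--Schwarz inequality for the inner product
  \<open>\<langle>S, S'\<rangle> + c \<langle>PS, PS'\<rangle>\<close> yields \<open>|\<xi>|\<^sup>2 \<le> (|\<nabla>\<phi>|\<^sup>2 + c|D\<phi>|\<^sup>2)(1 - t\<epsilon>)\<close>. If \<open>P\<nabla>\<phi> = 0\<close>, the plain
  inner product with \<open>t = 1/\<rho>\<^sup>2\<close> does the same.
\<close>

section \<open>Finite-dimensional inner product spaces inside an ambient vector space\<close>

locale inner_space =
  fixes V :: "'v::real_vector set" and g :: "'v \<Rightarrow> 'v \<Rightarrow> real"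
  assumes subspace: "subspace V"
    and inner_product: "inner_product_on V g"
    and finite_span: "\<exists>S. finite S \<and> V \<subseteq> span S"
begin

lemma sym: "u \<in> V \<Longrightarrow> v \<in> V \<Longrightarrow> g u v = g v u"
  using inner_product unfolding inner_product_on_def by metis

lemma add_right: "u \<in> V \<Longrightarrow> v \<in> V \<Longrightarrow> w \<in> V \<Longrightarrow> g u (v + w) = g u v + g u w"
  using inner_product unfolding inner_product_on_def linear_map_on_def by metis

lemma scale_right: "u \<in> V \<Longrightarrow> v \<in> V \<Longrightarrow> g u (r *\<^sub>R v) = r * g u v"
  using inner_product unfolding inner_product_on_def linear_map_on_def by auto

lemma pos: "v \<in> V \<Longrightarrow> v \<noteq> 0 \<Longrightarrow> g v v > 0"
  using inner_product unfolding inner_product_on_def by blast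

lemma closed [simp]:
  "0 \<in> V" "u \<in> V \<Longrightarrow> v \<in> V \<Longrightarrow> u + v \<in> V" "u \<in> V \<Longrightarrow> v \<in> V \<Longrightarrow> u - v \<in> V"
  "v \<in> V \<Longrightarrow> r *\<^sub>R v \<in> V" "(\<And>i. i \<in> I \<Longrightarrow> f i \<in> V) \<Longrightarrow> sum f I \<in> V"
  using subspace by (auto intro: subspace_0 subspace_add subspace_diff subspace_scale subspace_sum)

lemma add_left: "u \<in> V \<Longrightarrow> v \<in> V \<Longrightarrow> w \<in> V \<Longrightarrow> g (v + w) u = g v u + g w u"
  by (metis add_right sym closed(2))

lemma scale_left: "u \<in> V \<Longrightarrow> v \<in> V \<Longrightarrow> g (r *\<^sub>R v) u = r * g v u"
  by (metis scale_right sym closed(4))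

lemma zero_right: "u \<in> V \<Longrightarrow> g u 0 = 0"
  using scale_right[of u 0 0] by simp

lemma zero_left: "u \<in> V \<Longrightarrow> g 0 u = 0"
  using scale_left[of u 0 0] by simp

lemma diff_right: "u \<in> V \<Longrightarrow> v \<in> V \<Longrightarrow> w \<in> V \<Longrightarrow> g u (v - w) = g u v - g u w"
  using add_right[of u v "(-1) *\<^sub>R w"] scale_right[of u w "-1"] closed(4)[of w "-1"] by simp

lemma diff_left: "u \<in> V \<Longrightarrow> v \<in> V \<Longrightarrow> w \<in> V \<Longrightarrow> g (v - w) u = g v u - g w u"
  by (metis diff_right sym closed(3))

lemma sum_right: "u \<in> V \<Longrightarrow> (\<And>i. i \<in> I \<Longrightarrow> f i \<in> V) \<Longrightarrow> g u (sum f I) = (\<Sum>i\<in>I. g u (f i))"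
  by (induction I rule: infinite_finite_induct) (auto simp: zero_right add_right)

lemma sum_left: "u \<in> V \<Longrightarrow> (\<And>i. i \<in> I \<Longrightarrow> f i \<in> V) \<Longrightarrow> g (sum f I) u = (\<Sum>i\<in>I. g (f i) u)"
  by (induction I rule: infinite_finite_induct) (auto simp: zero_left add_left)

lemmas bilinear = add_left add_right diff_left diff_right scale_left scale_right

lemma nonneg: "v \<in> V \<Longrightarrow> g v v \<ge> 0"
  using pos[of v] zero_left[of v] by (cases "v = 0") auto

lemma norm_of_sq: "v \<in> V \<Longrightarrow> (norm_of g v)\<^sup>2 = g v v"
  by (simp add: norm_of_def nonneg)

lemma normalize:
  assumes "v \<in> V" "v \<noteq> 0"
  shows "g ((1 / norm_of g v) *\<^sub>R v) ((1 / norm_of g v) *\<^sub>R v) = 1"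
  using norm_of_sq[of v] pos[of v] assms
  by (simp add: bilinear power2_eq_square)

lemma Cauchy_Schwarz:
  assumes "u \<in> V" "v \<in> V"
  shows "(g u v)\<^sup>2 \<le> g u u * g v v"
proof (cases "v = 0")
  case False
  then have p: "g v v > 0" using assms pos by blast
  let ?w = "u - (g u v / g v v) *\<^sub>R v"
  have "0 \<le> g ?w ?w" by (rule nonneg) (use assms in auto)
  also have "g ?w ?w = g u u - (g u v)\<^sup>2 / g v v"
    using assms p by (simp add: bilinear sym[of v u] power2_eq_square)
  finally show ?thesis using p by (simp add: field_simps)
qed (use assms in \<open>simp add: zero_right\<close>)

text \<open>Phrased for orthonormal sets rather than bases because it also serves while a basis is
  being built: applied to a vanishing combination it yields independence, and applied to a
  projection it shows that the residual is orthogonal.\<close>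

lemma orthonormal_coefficient:
  assumes "finite B" "B \<subseteq> V" "\<forall>a\<in>B. \<forall>b\<in>B. g a b = (if a = b then 1 else 0)" "b \<in> B"
  shows "g (\<Sum>a\<in>B. r a *\<^sub>R a) b = r b"
proof -
  have "g (\<Sum>a\<in>B. r a *\<^sub>R a) b = (\<Sum>a\<in>B. r a * g a b)"
    using assms by (subst sum_left) (auto simp: scale_left subset_iff intro!: sum.cong)
  also have "\<dots> = (\<Sum>a\<in>B. if a = b then r a else 0)"
    using assms by (intro sum.cong) auto
  finally show ?thesis using assms by simp
qed

text \<open>In place of Gram-Schmidt, an orthonormal set of largest cardinality is taken.
  Orthonormal sets are independent, so a finite spanning set bounds their size; if a largest one
  failed to span some \<open>v\<close>, the normalized residual of \<open>v\<close> would enlarge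
  it.\<close>

lemma ex_orthonormal_basis: "\<exists>B. orthonormal_basis_on V g B"
proof -
  define on where "on B \<longleftrightarrow> finite B \<and> B \<subseteq> V \<and> (\<forall>a\<in>B. \<forall>b\<in>B. g a b = (if a = b then 1 else 0))" for B
  obtain S where S: "finite S" "V \<subseteq> span S" using finite_span by blast
  have bound: "card B \<le> card S" if onB: "on B" for B
  proof -
    have "independent B"
    proof
      assume "dependent B"
      then obtain r b where r: "b \<in> B" "r b \<noteq> 0" "(\<Sum>a\<in>B. r a *\<^sub>R a) = 0"
        using onB dependent_finite[of B] unfolding on_def by blast
      have "r b = g 0 b"
        using orthonormal_coefficient[of B b r] r that unfolding on_def by auto
      then show False using r that zero_left[of b] unfolding on_def by auto
    qed
    moreover have "B \<subseteq> span S" using that S unfolding on_def by blast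
    ultimately show ?thesis using independent_span_bound[OF S(1)] by blast
  qed
  \<comment> \<open>The empty set starts the search for a maximum, which needs a strict bound, hence
    \<open>Suc (card S)\<close>.\<close>
  have "on {}" by (simp add: on_def)
  then obtain B where B: "on B" and max: "\<And>C. on C \<Longrightarrow> card C \<le> card B"
    using ex_has_greatest_nat[of on "{}" card "Suc (card S)"] bound le_imp_less_Suc by blast
  have "V \<subseteq> span B"
  proof (rule ccontr)
    assume "\<not> V \<subseteq> span B"
    then obtain v where v: "v \<in> V" "v \<notin> span B" by blast
    \<comment> \<open>\<open>p\<close> is the orthogonal projection of \<open>v\<close> to
      \<open>span B\<close>; the residual \<open>w\<close> is nonzero because \<open>p\<close> lies
      in \<open>span B\<close> and \<open>v\<close> does not.\<close>
    define p where "p = (\<Sum>b\<in>B. g v b *\<^sub>R b)"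
    have pB: "p \<in> span B" unfolding p_def by (intro span_sum span_scale span_base)
    have BV: "B \<subseteq> V" using B unfolding on_def by blast
    have pV: "p \<in> V" unfolding p_def by (intro closed) (use BV in auto)
    define w where "w = v - p"
    have w: "w \<in> V" "w \<noteq> 0" using v pB pV unfolding w_def by auto
    have wb: "g w b = 0" if "b \<in> B" for b
      using orthonormal_coefficient[of B b "g v"] B that v pV BV
      unfolding w_def on_def p_def by (subst diff_left) auto
    define e where "e = (1 / norm_of g w) *\<^sub>R w"
    have e: "e \<in> V" "g e e = 1" using normalize[OF w] w unfolding e_def by auto
    have eb: "g e b = 0" "g b e = 0" if "b \<in> B" for b
      using wb[OF that] w(1) BV that sym[of e b] e(1) unfolding e_def
      by (auto simp: scale_left subset_iff)
    have "e \<notin> B" using eb(1)[of e] e(2) by auto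
    moreover have "on (insert e B)"
      using B e eb unfolding on_def by auto
    ultimately show False using max[of "insert e B"] B unfolding on_def by auto
  qed
  moreover have "span B \<subseteq> V" using B subspace unfolding on_def by (meson span_minimal)
  ultimately show ?thesis using B unfolding on_def orthonormal_basis_on_def by blast
qed

lemma orthonormal_expansion:
  assumes "orthonormal_basis_on V g B" "v \<in> V"
  shows "v = (\<Sum>b\<in>B. g v b *\<^sub>R b)"
proof -
  have B: "finite B" "B \<subseteq> V" "\<forall>a\<in>B. \<forall>b\<in>B. g a b = (if a = b then 1 else 0)" "v \<in> span B"
    using assms unfolding orthonormal_basis_on_def by auto
  then obtain r where "v = (\<Sum>b\<in>B. r b *\<^sub>R b)" by (auto simp: span_finite)
  then show ?thesis using orthonormal_coefficient[OF B(1-3)] by simp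
qed

end

section \<open>Linear maps, adjoints and conformal projections\<close>

lemma linear_map_on_sum:
  assumes "linear_map_on V W L" "subspace V" "finite I" "\<And>i. i \<in> I \<Longrightarrow> f i \<in> V"
  shows "L (\<Sum>i\<in>I. r i *\<^sub>R f i) = (\<Sum>i\<in>I. r i *\<^sub>R L (f i))"
  using assms(3,4)
proof (induction I rule: finite_induct)
  case empty
  have "L (0 *\<^sub>R 0) = 0 *\<^sub>R L 0"
    using assms(1,2) subspace_0 unfolding linear_map_on_def by blast
  then show ?case by simp
next
  case (insert i I)
  have "(\<Sum>i\<in>I. r i *\<^sub>R f i) \<in> V" "r i *\<^sub>R f i \<in> V"
    using insert.prems assms(2) by (auto intro!: subspace_sum subspace_scale)
  then show ?case using insert assms(1) by (simp add: linear_map_on_def)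
qed

lemma linear_map_on_diff:
  assumes "linear_map_on V W L" "subspace V" "u \<in> V" "v \<in> V"
  shows "L (u - r *\<^sub>R v) = L u - r *\<^sub>R L v"
proof -
  have "L (u + (- r) *\<^sub>R v) = L u + (- r) *\<^sub>R L v"
    using assms subspace_scale[OF assms(2,4)] unfolding linear_map_on_def by presburger
  then show ?thesis by simp
qed

text \<open>\<open>adjoint_on\<close> is a definite description, so its properties rest on existence
  and uniqueness. Existence is the Riesz formula in an orthonormal basis of \<open>V\<close>;
  uniqueness is the definiteness of \<open>g\<close>.\<close>

lemma adjoint_on_works:
  assumes "inner_space V g" "inner_space W h" "linear_map_on V W L" "w \<in> W"
  shows "adjoint_on V g h L w \<in> V" "v \<in> V \<Longrightarrow> g v (adjoint_on V g h L w) = h (L v) w"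
proof -
  interpret V: inner_space V g by fact
  interpret W: inner_space W h by fact
  obtain B where B: "orthonormal_basis_on V g B" using V.ex_orthonormal_basis by blast
  then have BV: "finite B" "b \<in> B \<Longrightarrow> b \<in> V" for b unfolding orthonormal_basis_on_def by auto
  have LW: "L v \<in> W" if "v \<in> V" for v using assms(3) that unfolding linear_map_on_def by blast
  define a where "a = (\<Sum>b\<in>B. h (L b) w *\<^sub>R b)"
  have a: "a \<in> V" using BV unfolding a_def by auto
  have ga: "g v a = h (L v) w" if v: "v \<in> V" for v
  proof -
    have "L v = (\<Sum>b\<in>B. g v b *\<^sub>R L b)"
      using linear_map_on_sum[OF assms(3) V.subspace BV(1), of "\<lambda>b. b" "g v"]
        V.orthonormal_expansion[OF B v] BV(2) by simp
    then have "h (L v) w = (\<Sum>b\<in>B. g v b * h (L b) w)"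
      using LW BV assms(4) by (simp add: W.sum_left W.scale_left)
    moreover have "g v a = (\<Sum>b\<in>B. h (L b) w * g v b)"
      unfolding a_def using BV v by (simp add: V.sum_right V.scale_right)
    ultimately show ?thesis by (simp add: mult.commute)
  qed
  have "\<exists>!u. u \<in> V \<and> (\<forall>v\<in>V. g v u = h (L v) w)"
  proof (intro ex1I[of _ a] conjI ballI)
    fix u assume u: "u \<in> V \<and> (\<forall>v\<in>V. g v u = h (L v) w)"
    then have "g (u - a) (u - a) = 0" using a ga V.closed(3) by (simp add: V.diff_right)
    then show "u = a" using V.pos[of "u - a"] u a by fastforce
  qed (use a ga in auto)
  from theI'[OF this, folded adjoint_on_def]
  show "adjoint_on V g h L w \<in> V" "v \<in> V \<Longrightarrow> g v (adjoint_on V g h L w) = h (L v) w" by auto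
qed

text \<open>Conformality enters through \<open>L a = \<rho>\<^sup>2 *\<^sub>R L u\<close>, where
  \<open>a\<close> is the adjoint applied to \<open>L u\<close>; this also fixes the length of
  \<open>a\<close>. Each of the first two bounds is a Cauchy-Schwarz inequality against
  \<open>u\<close> minus a multiple of \<open>a\<close>.\<close>

lemma conformal_Cauchy_Schwarz:
  assumes "inner_space V g" "inner_space W h" "conformal_projection V g W h L \<rho>"
    and c: "c \<ge> 0" and S: "S \<in> V" and u: "u \<in> V"
  shows "(g S u)\<^sup>2 \<le> (g S S + c * h (L S) (L S)) * (g u u - c / (1 + c * \<rho>\<^sup>2) * h (L u) (L u))"
    and "L S = 0 \<Longrightarrow> (g S u)\<^sup>2 \<le> g S S * (g u u - h (L u) (L u) / \<rho>\<^sup>2)"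
    and "h (L u) (L u) \<le> \<rho>\<^sup>2 * g u u"
proof -
  interpret V: inner_space V g by fact
  interpret W: inner_space W h by fact
  have L: "linear_map_on V W L" and rho: "\<rho> > 0"
    and conf: "\<And>w. w \<in> W \<Longrightarrow> L (adjoint_on V g h L w) = \<rho>\<^sup>2 *\<^sub>R w"
    using assms(3) unfolding conformal_projection_def by auto
  have LW: "L v \<in> W" if "v \<in> V" for v using L that unfolding linear_map_on_def by blast
  define a where "a = adjoint_on V g h L (L u)"
  have a: "a \<in> V" "\<And>v. v \<in> V \<Longrightarrow> g v a = h (L v) (L u)"
    using adjoint_on_works[OF assms(1,2) L LW[OF u]] unfolding a_def by auto
  have La: "L a = \<rho>\<^sup>2 *\<^sub>R L u" unfolding a_def by (rule conf[OF LW[OF u]])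
  have gaa: "g a a = \<rho>\<^sup>2 * h (L u) (L u)"
    using a LW[OF u] by (simp add: La W.scale_left)
  have gua: "g u a = h (L u) (L u)" "g a u = h (L u) (L u)"
    using a u V.sym[of a u] by auto
  {
    \<comment> \<open>This is the orthogonal projection of \<open>u\<close> to the kernel of
      \<open>L\<close>. Its squared length is nonnegative, which is the third claim, and an
      \<open>S\<close> in the kernel pairs with it as with \<open>u\<close>, which gives the
      second.\<close>
    let ?q = "u - (1 / \<rho>\<^sup>2) *\<^sub>R a"
    have q: "?q \<in> V" using a u by auto
    have "g ?q ?q = g u u - h (L u) (L u) / \<rho>\<^sup>2"
      using a(1) u rho by (simp add: V.bilinear gua gaa power2_eq_square)
    note qq = this
    show "h (L u) (L u) \<le> \<rho>\<^sup>2 * g u u"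
      using V.nonneg[OF q] rho unfolding qq by (simp add: field_simps)
    show "(g S u)\<^sup>2 \<le> g S S * (g u u - h (L u) (L u) / \<rho>\<^sup>2)" if "L S = 0"
    proof -
      have "g S ?q = g S u"
        using a S u LW[OF u] that by (simp add: V.bilinear W.zero_left)
      then show ?thesis using V.Cauchy_Schwarz[OF S q] by (simp add: qq)
    qed
  }
  \<comment> \<open>The term added to \<open>g\<close> is positive semidefinite because
    \<open>c \<ge> 0\<close>, so \<open>g'\<close> is again an inner product and the locale supplies
    its Cauchy-Schwarz inequality.\<close>
  define g' where "g' v w = g v w + c * h (L v) (L w)" for v w
  interpret V': inner_space V g'
  proof
    show "inner_product_on V g'"
      unfolding inner_product_on_def linear_map_on_def
    proof (intro conjI ballI allI impI)
      fix v w z r assume v: "v \<in> V" and w: "w \<in> V"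
      show "g' v w = g' w v"
        using v w V.sym[of v w] W.sym[of "L v" "L w"] LW by (simp add: g'_def)
      show "g' v (r *\<^sub>R w) = r *\<^sub>R g' v w"
        using v w L LW by (simp add: g'_def V.bilinear linear_map_on_def W.bilinear algebra_simps)
      assume z: "z \<in> V"
      show "g' v (w + z) = g' v w + g' v z"
        using v w z L LW by (simp add: g'_def V.bilinear linear_map_on_def W.bilinear algebra_simps)
    next
      fix v assume "v \<in> V" "v \<noteq> 0"
      then show "g' v v > 0"
        using V.pos[of v] W.nonneg[of "L v"] LW c by (simp add: g'_def add_pos_nonneg)
    qed auto
  qed (use V.subspace V.finite_span in auto)
  \<comment> \<open>\<open>t\<close> solves \<open>c * (1 - t * \<rho>\<^sup>2) = t\<close>. Then
    the contributions of \<open>a\<close> and of \<open>L ?q\<close> to \<open>g' v ?q\<close>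
    cancel, so that \<open>?q\<close> represents the functional sending \<open>v\<close> to
    \<open>g v u\<close> with respect to \<open>g'\<close>.\<close>
  define t where "t = c / (1 + c * \<rho>\<^sup>2)"
  have "1 + c * \<rho>\<^sup>2 > 0" using c by (simp add: add_pos_nonneg)
  then have t: "c * (1 - t * \<rho>\<^sup>2) = t" unfolding t_def by (simp add: field_simps)
  let ?q = "u - t *\<^sub>R a"
  have q: "?q \<in> V" using a u by auto
  have Lq: "L ?q = (1 - t * \<rho>\<^sup>2) *\<^sub>R L u"
    using linear_map_on_diff[OF L V.subspace u a(1), of t] by (simp add: La algebra_simps)
  have "g' v ?q = g v u" if "v \<in> V" for v
  proof -
    have "g' v ?q = g v u - t * h (L v) (L u) + (c * (1 - t * \<rho>\<^sup>2)) * h (L v) (L u)"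
      unfolding g'_def Lq using that a u LW by (simp add: V.bilinear W.bilinear)
    then show ?thesis unfolding t by simp
  qed
  note gq = this
  \<comment> \<open>The squared length of \<open>?q\<close> comes from the representation property
    with \<open>?q\<close> itself in the place of \<open>v\<close>.\<close>
  have "g' S ?q = g S u" "g' ?q ?q = g u u - t * h (L u) (L u)"
    using gq[OF S] gq[OF q] a u by (simp_all add: V.bilinear gua)
  then show "(g S u)\<^sup>2 \<le> (g S S + c * h (L S) (L S)) * (g u u - c / (1 + c * \<rho>\<^sup>2) * h (L u) (L u))"
    using V'.Cauchy_Schwarz[OF S q] by (simp add: g'_def t_def)
qed

section \<open>The inner product on spaces of homomorphisms\<close>

lemma inner_space_hom:
  assumes "inner_space V g" "inner_space W h"
  shows "inner_space (hom_space V W) (hom_inner V g h)"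
proof -
  interpret V: inner_space V g by fact
  interpret W: inner_space W h by fact
  define B where "B = (SOME B. orthonormal_basis_on V g B)"
  have B: "orthonormal_basis_on V g B"
    unfolding B_def by (rule someI_ex[OF V.ex_orthonormal_basis])
  then have BV: "finite B" "b \<in> B \<Longrightarrow> b \<in> V" for b unfolding orthonormal_basis_on_def by auto
  have hi: "hom_inner V g h = (\<lambda>S T. \<Sum>e\<in>B. h (S e) (T e))"
    unfolding hom_inner_def B_def by simp
  have homW: "T v \<in> W" if "T \<in> hom_space V W" "v \<in> V" for T v
    using that unfolding hom_space_def linear_map_on_def by blast
  obtain C where C: "orthonormal_basis_on W h C" using W.ex_orthonormal_basis by blast
  have sub: "subspace (hom_space V W)"
    unfolding subspace_def hom_space_def linear_map_on_def
    by (auto simp: scaleR_fun_def algebra_simps)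
  show ?thesis
  proof
    show "subspace (hom_space V W)" by fact
    show "inner_product_on (hom_space V W) (hom_inner V g h)"
      unfolding inner_product_on_def linear_map_on_def
    proof (intro conjI ballI allI impI)
      fix S T U r assume S: "S \<in> hom_space V W" and T: "T \<in> hom_space V W"
      show "hom_inner V g h S T = hom_inner V g h T S"
        unfolding hi using S T homW BV by (intro sum.cong) (auto intro: W.sym)
      show "hom_inner V g h S (r *\<^sub>R T) = r *\<^sub>R hom_inner V g h S T"
        unfolding hi using S T homW BV
        by (simp add: scaleR_fun_def W.scale_right sum_distrib_left)
      assume U: "U \<in> hom_space V W"
      show "hom_inner V g h S (T + U) = hom_inner V g h S T + hom_inner V g h S U"
        unfolding hi using S T U homW BV by (simp add: W.add_right sum.distrib)
    next
      fix T assume T: "T \<in> hom_space V W" "T \<noteq> 0"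
      \<comment> \<open>A map that vanishes on \<open>B\<close> vanishes on \<open>V\<close> by
        linearity and off \<open>V\<close> by the convention in \<open>hom_space\<close>. So a
        nonzero map is nonzero somewhere on \<open>B\<close>, and that one summand makes the sum
        positive.\<close>
      obtain e where e: "e \<in> B" "T e \<noteq> 0"
      proof (rule ccontr)
        assume "\<not> thesis"
        then have z: "\<forall>e\<in>B. T e = 0" using that by blast
        have "T v = 0" for v
        proof (cases "v \<in> V")
          case True
          have "T (\<Sum>b\<in>B. g v b *\<^sub>R b) = (\<Sum>b\<in>B. g v b *\<^sub>R T b)"
            using T BV by (intro linear_map_on_sum[OF _ V.subspace]) (auto simp: hom_space_def)
          then show ?thesis using V.orthonormal_expansion[OF B True] z by simp
        qed (use T in \<open>auto simp: hom_space_def\<close>)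
        then show False using T(2) by auto
      qed
      have "0 < h (T e) (T e)" using e BV T homW W.pos by blast
      also have "\<dots> \<le> hom_inner V g h T T"
        unfolding hi using e(1) BV T homW W.nonneg
        by (intro member_le_sum[of e B "\<lambda>e. h (T e) (T e)"]) auto
      finally show "hom_inner V g h T T > 0" .
    qed auto
    \<comment> \<open>These are the rank one tensors of the covectors dual to \<open>B\<close> with
      the vectors of \<open>C\<close>. The covectors are cut off outside \<open>V\<close> so that
      the expansion of \<open>T\<close> is an equality of functions everywhere.\<close>
    define G where "G = (\<lambda>(e, f). tensor (\<lambda>v. if v \<in> V then g v e else 0) f) ` (B \<times> C)"
    have "hom_space V W \<subseteq> span G"
    proof
      fix T assume T: "T \<in> hom_space V W"
      have "T = (\<Sum>e\<in>B. \<Sum>f\<in>C. h (T e) f *\<^sub>R tensor (\<lambda>v. if v \<in> V then g v e else 0) f)"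
      proof
        fix v
        have sf: "(\<Sum>i\<in>I. f i) v = (\<Sum>i\<in>I. f i v)" for I and f :: "'i \<Rightarrow> 'a \<Rightarrow> 'b"
          by (induction I rule: infinite_finite_induct) auto
        show "T v = (\<Sum>e\<in>B. \<Sum>f\<in>C. h (T e) f *\<^sub>R tensor (\<lambda>v. if v \<in> V then g v e else 0) f) v"
        proof (cases "v \<in> V")
          case True
          have "T v = T (\<Sum>b\<in>B. g v b *\<^sub>R b)" using V.orthonormal_expansion[OF B True] by simp
          also have "\<dots> = (\<Sum>b\<in>B. g v b *\<^sub>R T b)"
            using T BV by (intro linear_map_on_sum[OF _ V.subspace]) (auto simp: hom_space_def)
          also have "\<dots> = (\<Sum>b\<in>B. g v b *\<^sub>R (\<Sum>f\<in>C. h (T b) f *\<^sub>R f))"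
            using W.orthonormal_expansion[OF C] T BV homW by (intro sum.cong) auto
          finally show ?thesis
            using True by (simp add: sf scaleR_fun_def tensor_def scaleR_sum_right mult.commute)
        next
          case False
          then show ?thesis using T by (simp add: hom_space_def sf scaleR_fun_def tensor_def)
        qed
      qed
      also have "\<dots> \<in> span G"
        by (intro span_sum span_scale span_base) (auto simp: G_def)
      finally show "T \<in> span G" .
    qed
    moreover have "finite G"
      using BV(1) C unfolding G_def orthonormal_basis_on_def by auto
    ultimately show "\<exists>S. finite S \<and> hom_space V W \<subseteq> span S" by blast
  qed
qed

section \<open>Fibres of a vector bundle in a local trivialization\<close>

lemma triv_inv_fibre:
  assumes "vector_bundle A E" "t \<in> trivs E" "y \<in> fst t"
  shows "triv_inv E t y k \<in> fibre E y" "snd t y (triv_inv E t y k) = k"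
proof -
  have "bij_betw (snd t y) (fibre E y) UNIV"
    using assms unfolding vector_bundle_def by blast
  then have "k \<in> snd t y ` fibre E y" by (simp add: bij_betw_def)
  then show "triv_inv E t y k \<in> fibre E y" "snd t y (triv_inv E t y k) = k"
    unfolding triv_inv_def by (auto intro: inv_into_into f_inv_into_f)
qed

text \<open>The preimages of the standard basis form a frame: both sides lie in the fibre and have
  the same image under \<open>snd t y\<close>, which is linear and injective there.\<close>

lemma triv_expansion:
  fixes E :: "('p::{t2_space, second_countable_topology}, 'v::real_vector, 'k::euclidean_space) vbundle"
  assumes E: "vector_bundle A E" "t \<in> trivs E" "y \<in> fst t" and v: "v \<in> fibre E y"
  shows "v = (\<Sum>k\<in>Basis. (snd t y v \<bullet> k) *\<^sub>R triv_inv E t y k)"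
proof -
  have sub: "subspace (fibre E y)" and lin: "linear_map_on (fibre E y) UNIV (snd t y)"
    and inj: "inj_on (snd t y) (fibre E y)"
    using E unfolding vector_bundle_def bij_betw_def by blast+
  let ?w = "\<Sum>k\<in>Basis. (snd t y v \<bullet> k) *\<^sub>R triv_inv E t y k"
  have "?w \<in> fibre E y"
    using triv_inv_fibre[OF E] by (intro subspace_sum[OF sub] subspace_scale[OF sub]) auto
  moreover have "snd t y ?w = snd t y v"
    using triv_inv_fibre[OF E] by (simp add: linear_map_on_sum[OF lin sub] euclidean_representation)
  ultimately show ?thesis using inj v by (simp add: inj_on_eq_iff)
qed

lemma inner_space_fibre:
  assumes "riemannian_vector_bundle A E gE"
  shows "inner_space (fibre E x) (gE x)"
proof
  have E: "vector_bundle A E" using assms unfolding riemannian_vector_bundle_def by blast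
  then have "x \<in> (\<Union>t\<in>trivs E. fst t)" unfolding vector_bundle_def by blast
  then obtain t where t: "t \<in> trivs E" "x \<in> fst t" by blast
  have "fibre E x \<subseteq> span (triv_inv E t x ` Basis)"
  proof
    fix v assume "v \<in> fibre E x"
    then have "v = (\<Sum>k\<in>Basis. (snd t x v \<bullet> k) *\<^sub>R triv_inv E t x k)"
      by (rule triv_expansion[OF E t])
    also have "\<dots> \<in> span (triv_inv E t x ` Basis)"
      by (intro span_sum span_scale span_base) auto
    finally show "v \<in> span (triv_inv E t x ` Basis)" .
  qed
  then show "\<exists>S. finite S \<and> fibre E x \<subseteq> span S"
    using finite_imageI[OF finite_Basis] by metis
  show "subspace (fibre E x)" using E unfolding vector_bundle_def by blast
  show "inner_product_on (fibre E x) (gE x)"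
    using assms unfolding riemannian_vector_bundle_def bundle_metric_def by blast
qed

section \<open>Charts and tangent spaces\<close>

lemma manifold_smooth_on_differentiable:
  assumes "manifold_smooth_on A f U" "c \<in> charts_at A x" "x \<in> U"
  shows "(f \<circ> chart_inv c) differentiable (at (snd c x))"
proof -
  have "Ck_on (Suc 0) (f \<circ> chart_inv c) (snd c ` (fst c \<inter> U))"
    using assms unfolding manifold_smooth_on_def smooth_on_def charts_at_def by blast
  then show ?thesis using assms unfolding charts_at_def by auto
qed

lemma chart_inv_chart:
  assumes "smooth_atlas A" "c \<in> charts_at A x"
  shows "chart_inv c (snd c x) = x"
  using assms unfolding smooth_atlas_def charts_at_def homeomorphism_def by blast

lemma charts_at_nonempty: "smooth_atlas A \<Longrightarrow> (SOME c. c \<in> charts_at A x) \<in> charts_at A x"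
proof (rule someI_ex)
  assume "smooth_atlas A"
  then have "x \<in> (\<Union>c\<in>A. fst c)" unfolding smooth_atlas_def by blast
  then show "\<exists>c. c \<in> charts_at A x" unfolding charts_at_def by blast
qed

lemma linear_transition:
  assumes "smooth_atlas A" "c \<in> charts_at A x" "c' \<in> charts_at A x"
  shows "linear (frechet_derivative (snd c' \<circ> chart_inv c) (at (snd c x)))"
proof -
  have "Ck_on (Suc 0) (snd c' \<circ> chart_inv c) (snd c ` (fst c \<inter> fst c'))"
    using assms unfolding smooth_atlas_def smooth_on_def charts_at_def by blast
  then have "(snd c' \<circ> chart_inv c) differentiable (at (snd c x))"
    using assms unfolding charts_at_def by auto
  then show ?thesis by (rule linear_frechet_derivative)
qed

lemma tangent_transition:
  assumes "v \<in> tangent_space A x" "c \<in> charts_at A x" "c' \<in> charts_at A x"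
  shows "v c' = frechet_derivative (snd c' \<circ> chart_inv c) (at (snd c x)) (v c)"
  using assms unfolding tangent_space_def mem_Collect_eq by metis

lemma tangent_off_charts: "v \<in> tangent_space A x \<Longrightarrow> c \<notin> charts_at A x \<Longrightarrow> v c = 0"
  unfolding tangent_space_def by blast

text \<open>Tangent vectors are families indexed by all charts, so a finite spanning set is not
  evident. It exists because the coordinate vector in a single chart determines the whole
  family.\<close>

lemma inner_space_tangent:
  assumes "riemannian_manifold A gM"
  shows "inner_space (tangent_space A x) (gM x)"
proof
  have A: "smooth_atlas A" using assms unfolding riemannian_manifold_def by blast
  show "inner_product_on (tangent_space A x) (gM x)"
    using assms unfolding riemannian_manifold_def bundle_metric_def tangent_bundle_def by simp
  note lin = linear_transition[OF A]
  show "subspace (tangent_space A x)"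
    unfolding subspace_def
  proof (intro conjI ballI allI)
    fix u v r assume u: "u \<in> tangent_space A x" and v: "v \<in> tangent_space A x"
    show "u + v \<in> tangent_space A x"
      unfolding tangent_space_def
    proof (intro CollectI conjI ballI allI impI)
      fix c c' assume c: "c \<in> charts_at A x" "c' \<in> charts_at A x"
      then have "(u + v) c' = frechet_derivative (snd c' \<circ> chart_inv c) (at (snd c x)) (u c) +
          frechet_derivative (snd c' \<circ> chart_inv c) (at (snd c x)) (v c)"
        using tangent_transition[OF u] tangent_transition[OF v] by (metis plus_fun_apply)
      then show "(u + v) c' = frechet_derivative (snd c' \<circ> chart_inv c) (at (snd c x)) ((u + v) c)"
        using linear_add[OF lin[OF c]] by simp
    qed (simp add: tangent_off_charts[OF u] tangent_off_charts[OF v])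
    show "r *\<^sub>R u \<in> tangent_space A x"
      unfolding tangent_space_def
    proof (intro CollectI conjI ballI allI impI)
      fix c c' assume c: "c \<in> charts_at A x" "c' \<in> charts_at A x"
      then have "(r *\<^sub>R u) c' = r *\<^sub>R frechet_derivative (snd c' \<circ> chart_inv c) (at (snd c x)) (u c)"
        using tangent_transition[OF u] by (metis scaleR_fun_def)
      then show "(r *\<^sub>R u) c' = frechet_derivative (snd c' \<circ> chart_inv c) (at (snd c x)) ((r *\<^sub>R u) c)"
        using linear_scale[OF lin[OF c]] by (simp add: scaleR_fun_def)
    qed (simp add: tangent_off_charts[OF u] scaleR_fun_def)
  qed (simp add: tangent_space_def linear_0[OF lin])
  define c where "c = (SOME c. c \<in> charts_at A x)"
  have c: "c \<in> charts_at A x" unfolding c_def by (rule charts_at_nonempty[OF A])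
  \<comment> \<open>\<open>G w\<close> rebuilds a family from its coordinate vector \<open>w\<close>
    in the chart \<open>c\<close>. It is linear in \<open>w\<close>, and every tangent vector
    \<open>v\<close> equals \<open>G (v c)\<close>.\<close>
  define G where "G w = (\<lambda>c'. if c' \<in> charts_at A x
      then frechet_derivative (snd c' \<circ> chart_inv c) (at (snd c x)) w else 0)" for w
  have "linear G"
    by (rule linearI; rule ext) (simp_all add: G_def scaleR_fun_def linear_add[OF lin[OF c]]
        linear_scale[OF lin[OF c]])
  have "tangent_space A x \<subseteq> span (G ` Basis)"
  proof
    fix v assume v: "v \<in> tangent_space A x"
    have "v = G (v c)"
    proof
      fix c'
      show "v c' = G (v c) c'"
      proof (cases "c' \<in> charts_at A x")
        case True
        then show ?thesis using tangent_transition[OF v c True] by (simp add: G_def)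
      next
        case False
        then show ?thesis using tangent_off_charts[OF v] by (simp add: G_def)
      qed
    qed
    also have "\<dots> \<in> span (G ` Basis)"
      using linear_span_image[OF \<open>linear G\<close>, of Basis] by auto
    finally show "v \<in> span (G ` Basis)" .
  qed
  then show "\<exists>S. finite S \<and> tangent_space A x \<subseteq> span S"
    using finite_imageI[OF finite_Basis] by metis
qed

section \<open>The differential of the norm of a section\<close>

lemma section_metric_differentiable:
  assumes A: "smooth_atlas A" and E: "riemannian_vector_bundle A E gE"
    and s: "s \<in> sections A E" and c: "c \<in> charts_at A x"
  shows "((\<lambda>y. gE y (s y) (s y)) \<circ> chart_inv c) differentiable (at (snd c x))"
proof -
  have VE: "vector_bundle A E" and g: "bundle_metric A E gE"
    using E unfolding riemannian_vector_bundle_def by auto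
  then have "x \<in> (\<Union>t\<in>trivs E. fst t)" unfolding vector_bundle_def by blast
  then obtain t where t: "t \<in> trivs E" "x \<in> fst t" by blast
  \<comment> \<open>\<open>bundle_metric\<close> asserts smoothness for pairings of frame vectors,
    so the squared length of \<open>s\<close> is expanded in the frame of \<open>t\<close>. The
    expansion is valid on \<open>fst t\<close> only.\<close>
  define f where "f y = (\<Sum>k\<in>Basis. \<Sum>l\<in>Basis. (snd t y (s y) \<bullet> k) * (snd t y (s y) \<bullet> l) *
      gE y (triv_inv E t y l) (triv_inv E t y k))" for y
  have f: "gE y (s y) (s y) = f y" if y: "y \<in> fst t" for y
  proof -
    interpret inner_space "fibre E y" "gE y" by (rule inner_space_fibre[OF E])
    have sy: "s y \<in> fibre E y" using s unfolding sections_def by blast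
    let ?e = "triv_inv E t y" and ?r = "\<lambda>k. snd t y (s y) \<bullet> k"
    have e: "?e k \<in> fibre E y" for k using triv_inv_fibre[OF VE t(1) y] by blast
    have "gE y (s y) (s y) = gE y (\<Sum>k\<in>Basis. ?r k *\<^sub>R ?e k) (\<Sum>l\<in>Basis. ?r l *\<^sub>R ?e l)"
      using triv_expansion[OF VE t(1) y sy] by simp
    also have "\<dots> = (\<Sum>k\<in>Basis. \<Sum>l\<in>Basis. ?r k * (?r l * gE y (?e l) (?e k)))"
      using e by (simp add: sum_left sum_right scale_left scale_right sum_distrib_left)
    finally show ?thesis by (simp add: f_def mult.assoc)
  qed
  have d1: "((\<lambda>y. snd t y (s y)) \<circ> chart_inv c) differentiable (at (snd c x))"
    using s t c unfolding sections_def by (blast intro: manifold_smooth_on_differentiable)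
  have d2: "((\<lambda>y. gE y (triv_inv E t y k) (triv_inv E t y l)) \<circ> chart_inv c)
      differentiable (at (snd c x))" for k l
    using g t c unfolding bundle_metric_def by (blast intro: manifold_smooth_on_differentiable)
  have "(f \<circ> chart_inv c) differentiable (at (snd c x))"
    unfolding f_def comp_def
    by (intro differentiable_sum differentiable_mult differentiable_inner)
      (use d1 d2 in \<open>auto simp: comp_def\<close>)
  then obtain f' where f': "((f \<circ> chart_inv c) has_derivative f') (at (snd c x))"
    unfolding differentiable_def by blast
  have hom: "open (snd c ` fst c)" "homeomorphism (fst c) (snd c ` fst c) (snd c) (chart_inv c)"
    using A c unfolding smooth_atlas_def charts_at_def by auto
  \<comment> \<open>Agreement on \<open>fst t\<close> suffices for the derivative: the inverse chart
    is continuous and maps points near \<open>snd c x\<close> into this open set.\<close>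
  have "isCont (chart_inv c) (snd c x)"
    using hom c unfolding homeomorphism_def charts_at_def
    by (auto intro: continuous_on_interior simp: interior_open)
  moreover have "open (fst t)" using VE t unfolding vector_bundle_def by blast
  ultimately have "\<forall>\<^sub>F p in at (snd c x). chart_inv c p \<in> fst t"
    using t(2) chart_inv_chart[OF A c] unfolding isCont_def by (auto dest: topological_tendstoD)
  then have "\<forall>\<^sub>F p in at (snd c x).
      (f \<circ> chart_inv c) p = ((\<lambda>y. gE y (s y) (s y)) \<circ> chart_inv c) p"
    by eventually_elim (simp add: f)
  then have "(((\<lambda>y. gE y (s y) (s y)) \<circ> chart_inv c) has_derivative f') (at (snd c x))"
    using has_derivative_transform_eventually[OF f'] f[OF t(2)] chart_inv_chart[OF A c] by simp
  then show ?thesis unfolding differentiable_def by blast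
qed

text \<open>The chain rule for the square root, which is differentiable at the positive number
  \<open>gE x (s x) (s x)\<close>. Both differentials use the same chosen chart, and both sides are
  0 when \<open>X\<close> is not tangent at \<open>x\<close>.\<close>

lemma differential_norm:
  assumes A: "smooth_atlas A" and E: "riemannian_vector_bundle A E gE"
    and s: "s \<in> sections A E" and nz: "s x \<noteq> 0"
  shows "differential A (\<lambda>y. norm_of (gE y) (s y)) x X =
    differential A (\<lambda>y. gE y (s y) (s y)) x X / (2 * norm_of (gE x) (s x))"
proof -
  interpret inner_space "fibre E x" "gE x" by (rule inner_space_fibre[OF E])
  define c where "c = (SOME c. c \<in> charts_at A x)"
  have c: "c \<in> charts_at A x" unfolding c_def by (rule charts_at_nonempty[OF A])
  let ?h = "(\<lambda>y. gE y (s y) (s y)) \<circ> chart_inv c"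
  let ?h' = "frechet_derivative ?h (at (snd c x))"
  have "s x \<in> fibre E x" using s unfolding sections_def by blast
  then have pos: "?h (snd c x) > 0" using pos nz by (simp add: chart_inv_chart[OF A c])
  have "(?h has_derivative ?h') (at (snd c x))"
    using section_metric_differentiable[OF A E s c] by (simp add: frechet_derivative_works)
  from has_derivative_real_sqrt[OF pos this]
  have "((\<lambda>p. sqrt (?h p)) has_derivative (\<lambda>w. ?h' w / (2 * sqrt (?h (snd c x))))) (at (snd c x))"
    by (simp add: field_simps)
  then have "frechet_derivative ((\<lambda>y. norm_of (gE y) (s y)) \<circ> chart_inv c) (at (snd c x)) =
      (\<lambda>w. ?h' w / (2 * norm_of (gE x) (s x)))"
    unfolding norm_of_def comp_def
    by (metis (no_types, lifting) frechet_derivative_at chart_inv_chart[OF A c])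
  then show ?thesis
    unfolding differential_def Let_def c_def[symmetric] by simp
qed

section \<open>Tensors, covectors and the ellipticity constant\<close>

lemma hom_inner_cong:
  assumes "inner_space V g" "\<And>v. v \<in> V \<Longrightarrow> h (S v) (T v) = h' (S' v) (T' v)"
  shows "hom_inner V g h S T = hom_inner V g h' S' T'"
proof -
  have "orthonormal_basis_on V g (SOME B. orthonormal_basis_on V g B)"
    by (rule someI_ex[OF inner_space.ex_orthonormal_basis[OF assms(1)]])
  then show ?thesis
    unfolding hom_inner_def orthonormal_basis_on_def using assms(2) by (intro sum.cong) auto
qed

lemma tensor_in_hom_space:
  assumes "\<xi> \<in> hom_space V UNIV" "subspace W" "w \<in> W"
  shows "tensor \<xi> w \<in> hom_space V W"
  using assms unfolding hom_space_def linear_map_on_def tensor_def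
  by (auto simp: algebra_simps intro: subspace_scale)

text \<open>Makes the dual metric on covectors an instance of
  \<open>inner_space_hom\<close>.\<close>

lemma inner_space_real: "inner_space (UNIV :: real set) (*)"
proof
  show "inner_product_on UNIV ((*) :: real \<Rightarrow> real \<Rightarrow> real)"
    unfolding inner_product_on_def linear_map_on_def
    by (auto simp: algebra_simps zero_less_mult_iff)
  show "\<exists>S. finite S \<and> (UNIV :: real set) \<subseteq> span S"
    using span_Basis finite_Basis by blast
qed auto

text \<open>Real infima are lower bounds only for families bounded below. Squares bound the inner
  family by 0, and \<open>v\<close> makes its index set nonempty, so that 0 also bounds the inner
  infima.\<close>

lemma ellipticity_constant_le:
  assumes "\<xi> \<in> unit_covectors A gM x" "v \<in> fibre E x" "norm_of (gE x) v = 1"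
  shows "ellipticity_constant A gM E gE gF P x \<le> (norm_of (gF x) (symbol_at P x \<xi> v))\<^sup>2"
proof -
  let ?f = "\<lambda>\<xi> v. (norm_of (gF x) (symbol_at P x \<xi> v))\<^sup>2"
  let ?V = "{v \<in> fibre E x. norm_of (gE x) v = 1}"
  have v: "v \<in> ?V" using assms by simp
  have "0 \<le> (INF v\<in>?V. ?f \<eta> v)" for \<eta>
    using v by (intro cINF_greatest) auto
  then have "ellipticity_constant A gM E gE gF P x \<le> (INF v\<in>?V. ?f \<xi> v)"
    unfolding ellipticity_constant_def using assms(1)
    by (intro cINF_lower bdd_belowI[of _ 0]) auto
  also have "\<dots> \<le> ?f \<xi> v"
    using v by (intro cINF_lower bdd_belowI[of _ 0]) auto
  finally show ?thesis .
qed

lemma fibre_cotensor_bundle: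
  "fibre (cotensor_bundle A E) x = hom_space (tangent_space A x) (fibre E x)"
  by (simp add: cotensor_bundle_def hom_bundle_def tangent_bundle_def)

lemma fibre_cotangent_bundle:
  "fibre (cotangent_bundle A) x = hom_space (tangent_space A x) UNIV"
  by (simp add: cotangent_bundle_def hom_bundle_def tangent_bundle_def line_bundle_def)

lemma cotensor_metric_eq: "cotensor_metric A gM gE x = hom_inner (tangent_space A x) (gM x) (gE x)"
  by (simp add: cotensor_metric_def hom_metric_def tangent_bundle_def)

lemma cotangent_metric_eq: "cotangent_metric A gM x = hom_inner (tangent_space A x) (gM x) (*)"
  by (simp add: cotangent_metric_def hom_metric_def tangent_bundle_def)

text \<open>Here \<open>n\<close> stands for the squared length of the covector and \<open>q\<close>
  for that of the image of the tensor under the symbol. The lower bound for \<open>q\<close> is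
  inserted into the Cauchy-Schwarz estimate and one factor \<open>n\<close> is cancelled.\<close>

lemma le_of_square_le:
  fixes n K t q \<epsilon> :: real
  assumes "n > 0" "K \<ge> 0" "t \<ge> 0" "\<epsilon> * n \<le> q" "n\<^sup>2 \<le> K * (n - t * q)"
  shows "n \<le> K * (1 - t * \<epsilon>)"
proof -
  have "n * n \<le> K * (n - t * q)" using assms(5) by (simp add: power2_eq_square)
  also have "\<dots> \<le> K * (n - t * (\<epsilon> * n))"
    using assms by (intro mult_left_mono diff_mono mult_left_mono) auto
  also have "\<dots> = n * (K * (1 - t * \<epsilon>))" by (simp add: algebra_simps)
  finally show ?thesis using assms(1) by simp
qed

section \<open>The pointwise inequality\<close>

theorem theorem1p1:
  fixes A :: "('p::{t2_space, second_countable_topology}, 'm::euclidean_space) chart set"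
    and gM :: "'p \<Rightarrow> (('p, 'm) chart \<Rightarrow> 'm) \<Rightarrow> (('p, 'm) chart \<Rightarrow> 'm) \<Rightarrow> real"
    and E :: "('p, 'v::real_vector, 'j::euclidean_space) vbundle"
    and gE :: "'p \<Rightarrow> 'v \<Rightarrow> 'v \<Rightarrow> real"
    and F :: "('p, 'w::real_vector, 'k::euclidean_space) vbundle"
    and gF :: "'p \<Rightarrow> 'w \<Rightarrow> 'w \<Rightarrow> real"
    and nabla :: "('p \<Rightarrow> 'v) \<Rightarrow> 'p \<Rightarrow> (('p, 'm) chart \<Rightarrow> 'm) \<Rightarrow> 'v"
    and P :: "'p \<Rightarrow> ((('p, 'm) chart \<Rightarrow> 'm) \<Rightarrow> 'v) \<Rightarrow> 'w"
    and D :: "('p \<Rightarrow> 'v) \<Rightarrow> 'p \<Rightarrow> 'w"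
    and \<phi> :: "'p \<Rightarrow> 'v" and x :: 'p
    and c \<rho> \<epsilon> c_tilde :: real
  assumes "riemannian_manifold A gM"
    and "riemannian_vector_bundle A E gE"
    and "riemannian_vector_bundle A F gF"
    and "first_order_operator A E gE F nabla P D"
    and "conformal A gM E gE F gF P"
    and "\<forall>y. injectively_elliptic_at A gM E gE gF P y"
    and "c \<ge> 0"
    and "\<phi> \<in> sections A E"
    and "\<phi> x \<noteq> 0"
    and "conformity_factor_at A gM E gE F gF P x \<rho>"
    and "\<epsilon> = ellipticity_constant A gM E gE gF P x"
    and "c_tilde = (if D \<phi> x = 0 then \<epsilon> / (\<rho>\<^sup>2 - \<epsilon>) else \<epsilon> * c / (1 + (\<rho>\<^sup>2 - \<epsilon>) * c))"
  shows "(norm_of (cotensor_metric A gM gE x) (nabla \<phi> x))\<^sup>2 + c * (norm_of (gF x) (D \<phi> x))\<^sup>2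
    \<ge> (1 + c_tilde) *
        (norm_of (cotangent_metric A gM x) (differential A (\<lambda>y. norm_of (gE y) (\<phi> y)) x))\<^sup>2"
  proof -
  have A: "smooth_atlas A" using assms(1) unfolding riemannian_manifold_def by blast
  note E = assms(2)
  let ?T = "tangent_space A x" and ?V = "fibre E x"
  let ?H = "hom_space ?T ?V" and ?h = "hom_inner ?T (gM x) (gE x)"
  let ?C = "hom_space ?T (UNIV :: real set)" and ?k = "hom_inner ?T (gM x) ((*) :: real \<Rightarrow> _)"
  have T: "inner_space ?T (gM x)" by (rule inner_space_tangent[OF assms(1)])
  interpret V: inner_space ?V "gE x" by (rule inner_space_fibre[OF E])
  interpret W: inner_space "fibre F x" "gF x" by (rule inner_space_fibre[OF assms(3)])
  interpret H: inner_space ?H ?h by (rule inner_space_hom[OF T V.inner_space_axioms])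
  interpret C: inner_space ?C ?k by (rule inner_space_hom[OF T inner_space_real])
  define N where "N = nabla \<phi> x"
  define d where "d = differential A (\<lambda>y. norm_of (gE y) (\<phi> y)) x"
  define w where "w = (1 / norm_of (gE x) (\<phi> x)) *\<^sub>R \<phi> x"
  have nabla: "metric_connection A E gE nabla" and D: "D \<phi> x = P x N"
    using assms(4,8) unfolding first_order_operator_def N_def by auto
  then have "nabla \<phi> \<in> sections A (cotensor_bundle A E)"
    using assms(8) unfolding metric_connection_def connection_def by blast
  then have N: "N \<in> ?H"
    unfolding sections_def N_def fibre_cotensor_bundle[symmetric] by blast
  have NV: "N X \<in> ?V" if "X \<in> ?T" for X
    using N that unfolding hom_space_def linear_map_on_def by blast
  have phi: "\<phi> x \<in> ?V" using assms(8) unfolding sections_def by blast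
  have w: "w \<in> ?V" "gE x w w = 1"
    using V.normalize[OF phi assms(9)] phi unfolding w_def by auto
  \<comment> \<open>The two terms of metric compatibility coincide by symmetry, and their sum
    cancels the factor 2 in \<open>differential_norm\<close>.\<close>
  have dX: "d X = gE x (N X) w" if X: "X \<in> ?T" for X
  proof -
    have "differential A (\<lambda>y. gE y (\<phi> y) (\<phi> y)) x X =
        gE x (N X) (\<phi> x) + gE x (\<phi> x) (N X)"
      using nabla assms(8) X unfolding metric_connection_def N_def by blast
    then show ?thesis
      using V.sym[OF phi NV[OF X]] phi NV[OF X]
      unfolding d_def w_def differential_norm[OF A E assms(8,9)] by (simp add: V.scale_right)
  qed
  have d_off: "d X = 0" if "X \<notin> ?T" for X
    using that unfolding d_def differential_def by simp
  \<comment> \<open>Linearity of \<open>d\<close> is inherited from \<open>N\<close> through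
    \<open>dX\<close>.\<close>
  have d: "d \<in> ?C"
  proof -
    have "linear_map_on ?T UNIV d"
      using N NV w(1) inner_space.closed(2,4)[OF T] unfolding hom_space_def linear_map_on_def
      by (simp add: dX V.add_left V.scale_left)
    then show ?thesis using d_off unfolding hom_space_def by simp
  qed
  define n where "n = ?k d d"
  have n: "(norm_of (cotangent_metric A gM x) d)\<^sup>2 = n"
    unfolding cotangent_metric_eq n_def by (rule C.norm_of_sq[OF d])
  have conf: "conformal_projection ?H ?h (fibre F x) (gF x) (P x) \<rho>"
    using assms(10) unfolding conformity_factor_at_def fibre_cotensor_bundle cotensor_metric_eq .
  then have lin: "linear_map_on ?H (fibre F x) (P x)" and rho: "\<rho> > 0"
    unfolding conformal_projection_def by auto
  have PF: "P x S \<in> fibre F x" if "S \<in> ?H" for S using lin that unfolding linear_map_on_def by blast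
  define K where "K = ?h N N"
  define M where "M = gF x (P x N) (P x N)"
  have K: "(norm_of (cotensor_metric A gM gE x) N)\<^sup>2 = K" "K \<ge> 0"
    unfolding cotensor_metric_eq K_def using H.norm_of_sq[OF N] H.nonneg[OF N] by auto
  have M: "(norm_of (gF x) (D \<phi> x))\<^sup>2 = M" "M \<ge> 0"
    unfolding D M_def using W.norm_of_sq[OF PF[OF N]] W.nonneg[OF PF[OF N]] by auto
  have "(1 + c_tilde) * n \<le> K + c * M"
  \<comment> \<open>If \<open>d = 0\<close>, the left-hand side is 0 whatever the value of
    \<open>c_tilde\<close>, even with a vanishing denominator. Otherwise \<open>n > 0\<close> can be
    cancelled.\<close>
  proof (cases "d = 0")
    case True
    then show ?thesis using K M assms(7) C.zero_left[of 0] by (simp add: n_def)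
  next
    case False
    have n0: "n > 0" unfolding n_def by (rule C.pos[OF d False])
    define u where "u = tensor d w"
    have u: "u \<in> ?H" unfolding u_def by (rule tensor_in_hom_space[OF d V.subspace w(1)])
    \<comment> \<open>\<open>hom_inner\<close> picks its basis from the tangent space and
      \<open>gM x\<close> alone, so fibre valued and real valued maps are summed over the same basis
      and compare termwise.\<close>
    have Nu: "?h N u = n"
      unfolding n_def u_def using dX NV w by (intro hom_inner_cong[OF T]) (simp add: tensor_def V.scale_right)
    have uu: "?h u u = n"
      unfolding n_def u_def using w by (intro hom_inner_cong[OF T]) (simp add: tensor_def V.scale_right V.scale_left)
    define q where "q = gF x (P x u) (P x u)"
    define r where "r = norm_of ?k d"
    have r: "r\<^sup>2 = n" unfolding r_def n_def by (rule C.norm_of_sq[OF d])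
    then have r0: "r \<noteq> 0" using n0 by auto
    \<comment> \<open>The ellipticity constant refers to unit covectors, so \<open>d\<close> is
      normalized; homogeneity of \<open>P x\<close> restores the factor
      \<open>r\<^sup>2 = n\<close>.\<close>
    define \<eta> where "\<eta> = (1 / r) *\<^sub>R d"
    have eta: "\<eta> \<in> ?C" "?k \<eta> \<eta> = 1"
      using d C.normalize[OF d False] unfolding \<eta>_def r_def by auto
    have "\<eta> \<in> unit_covectors A gM x"
      unfolding unit_covectors_def fibre_cotangent_bundle cotangent_metric_eq norm_of_def
      using eta by simp
    moreover have "norm_of (gE x) w = 1" using w by (simp add: norm_of_def)
    ultimately have "\<epsilon> \<le> (norm_of (gF x) (symbol_at P x \<eta> w))\<^sup>2"
      unfolding assms(11) using w by (intro ellipticity_constant_le)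
    also have \<eta>w: "tensor \<eta> w \<in> ?H" by (rule tensor_in_hom_space[OF eta(1) V.subspace w(1)])
    then have "(norm_of (gF x) (symbol_at P x \<eta> w))\<^sup>2 =
        gF x (P x (tensor \<eta> w)) (P x (tensor \<eta> w))"
      unfolding symbol_at_def by (intro W.norm_of_sq PF)
    finally have "\<epsilon> * n \<le> r\<^sup>2 * gF x (P x (tensor \<eta> w)) (P x (tensor \<eta> w))"
      using n0 r by simp
    also have "\<dots> = q"
    proof -
      have "u = r *\<^sub>R tensor \<eta> w"
        unfolding u_def \<eta>_def tensor_def scaleR_fun_def using r0 by simp
      then have "P x u = r *\<^sub>R P x (tensor \<eta> w)" using lin \<eta>w unfolding linear_map_on_def by blast
      then show ?thesis
        using PF[OF \<eta>w] by (simp add: q_def W.scale_left W.scale_right power2_eq_square)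
    qed
    finally have q: "\<epsilon> * n \<le> q" .
    note CS = conformal_Cauchy_Schwarz[OF H.inner_space_axioms W.inner_space_axioms conf assms(7) N u,
        unfolded Nu uu, folded q_def K_def M_def]
    \<comment> \<open>The lower and upper bounds for \<open>q\<close> together give
      \<open>\<epsilon> \<le> \<rho>\<^sup>2\<close>, which settles the signs of the denominators
      below.\<close>
    have "\<epsilon> * n \<le> \<rho>\<^sup>2 * n" using q CS(3) by simp
    then have eps: "\<epsilon> \<le> \<rho>\<^sup>2" using n0 by simp
    show ?thesis
    proof (cases "D \<phi> x = 0")
      case True
      then have z: "P x N = 0" "M = 0"
        using D W.zero_left[of 0] by (simp_all add: M_def)
      \<comment> \<open>The factor \<open>1 / \<rho>\<^sup>2\<close> is the limit of
        \<open>c / (1 + c * \<rho>\<^sup>2)\<close> for large \<open>c\<close>; it is available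
        because \<open>N\<close> lies in the kernel of \<open>P x\<close>.\<close>
      have le: "n \<le> K * (1 - 1 / \<rho>\<^sup>2 * \<epsilon>)"
        using CS(2)[OF z(1)] n0 K(2) q by (intro le_of_square_le[of n K _ _ q]) auto
      \<comment> \<open>This excludes the junk value of \<open>\<epsilon> / (\<rho>\<^sup>2 - \<epsilon>)\<close>: if \<open>\<epsilon> = \<rho>\<^sup>2\<close> then \<open>d|\<phi>|\<close> vanishes at \<open>x\<close>.\<close>
      then have "\<epsilon> \<noteq> \<rho>\<^sup>2" using n0 rho by auto
      then have lt: "\<rho>\<^sup>2 - \<epsilon> > 0" using eps by simp
      have "(1 + c_tilde) * n = \<rho>\<^sup>2 / (\<rho>\<^sup>2 - \<epsilon>) * n"
        using True lt by (simp add: assms(12) field_simps)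
      also have "\<dots> \<le> \<rho>\<^sup>2 / (\<rho>\<^sup>2 - \<epsilon>) * (K * (1 - 1 / \<rho>\<^sup>2 * \<epsilon>))"
        using le lt by (intro mult_left_mono) auto
      also have "1 - 1 / \<rho>\<^sup>2 * \<epsilon> = (\<rho>\<^sup>2 - \<epsilon>) / \<rho>\<^sup>2"
        using rho by (simp add: field_simps)
      also have "\<rho>\<^sup>2 / (\<rho>\<^sup>2 - \<epsilon>) * (K * ((\<rho>\<^sup>2 - \<epsilon>) / \<rho>\<^sup>2)) = K" using lt rho by simp
      finally show ?thesis using z by simp
    next
      case False
      \<comment> \<open>\<open>a\<close> is the denominator of the optimal factor
        \<open>c / a\<close>, and \<open>b\<close> is that of \<open>c_tilde\<close>. Since
        \<open>a - c * \<epsilon> = b\<close>, the numbers \<open>1 + c_tilde = a / b\<close> and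
        \<open>1 - c / a * \<epsilon> = b / a\<close> are reciprocal.\<close>
      define a where "a = 1 + c * \<rho>\<^sup>2"
      define b where "b = 1 + (\<rho>\<^sup>2 - \<epsilon>) * c"
      have ab: "a > 0" "b > 0" "a - c * \<epsilon> = b"
        using assms(7) eps by (auto simp: a_def b_def add_pos_nonneg) (simp add: algebra_simps)
      have le: "n \<le> (K + c * M) * (1 - c / a * \<epsilon>)"
        using CS(1) n0 K(2) M(2) q assms(7) ab(1) unfolding a_def[symmetric]
        by (intro le_of_square_le[of n _ _ _ q]) auto
      have f: "1 - c / a * \<epsilon> = b / a" using ab by (simp add: field_simps)
      have "c_tilde = \<epsilon> * c / b" using False by (simp add: assms(12) b_def)
      then have "(1 + c_tilde) * n = a / b * n"
        using ab by (simp add: field_simps)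
      also have "\<dots> \<le> a / b * ((K + c * M) * (b / a))"
        using le ab unfolding f by (intro mult_left_mono) auto
      also have "\<dots> = K + c * M" using ab by simp
      finally show ?thesis .
    qed
  qed
  then show ?thesis
    using n K(1) M(1) by (simp add: d_def N_def)
qed

end
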